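(* Let $R\in SO(p)$ be an involution of level $2$. If $R$ is sign-change reducible, then it is reducible by a sign-change of level $2$.
   Context: Let $p\ge2$. $SO(p)$ carries the bi-invariant Riemannian metric given at the identity by $g_{SO}(A_1,A_2)=-\frac12\mathrm{tr}(A_1A_2)$, with geodesic distance $d_{SO}$; thus $d_{SO}(U,V)=\min\{\frac{1}{\sqrt2}\|A\|_F : A\in\mathfrak{so}(p),\ \exp(A)=U^{-1}V\}$. An involution is an $R\in SO(p)$ with $R^2=I\ne R$; its level is $\dim E_{-1}(R)$, the dimension of its $(-1)$-eigenspace. $\mathcal{I}_p^+=\{\sigma\in\{\pm1\}^p:\prod_i\sigma_i=1\}$, $I_\sigma=\mathrm{diag}(\sigma_1,\dots,\sigma_p)$, and the level of $\sigma$ is $\#\{i:\sigma_i=-1\}$. $R\in SO(p)$ is sign-change reducible if $d_{SO}(RI_\sigma,I)<d_{SO}(R,I)$ for some $\sigma\in\mathcal{I}_p^+$; an involution $R$ is reducible by a sign-change of level $m$ if such a $\sigma$ exists with level $m$. *)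

theory Defs
  imports "HOL-Analysis.Analysis"
begin

text \<open>
  The size \<open>p\<close> is \<open>CARD('n)\<close>, and the coordinates are indexed by the finite type \<open>'n\<close>.
  The multiplication \<open>*\<close> and power that the library puts on \<open>real^'n^'n\<close> are
  componentwise, so matrix powers and the matrix exponential are defined here from \<open>**\<close>.
\<close>

definition SO :: "(real^'n^'n) set" where
  "SO = {Q. rotation_matrix Q}"

definition so :: "(real^'n^'n) set" where
  "so = {A. transpose A = - A}"

definition mat_pow :: "real^'n^'n \<Rightarrow> nat \<Rightarrow> real^'n^'n" where
  "mat_pow A k = ((\<lambda>B. A ** B) ^^ k) (mat 1)"

definition mat_exp :: "real^'n^'n \<Rightarrow> real^'n^'n" where
  "mat_exp A = (\<Sum>k. (1 / fact k) *\<^sub>R mat_pow A k)"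

definition g_SO :: "real^'n^'n \<Rightarrow> real^'n^'n \<Rightarrow> real" where
  "g_SO A B = - (1/2) * trace (A ** B)"

text \<open>
  The geodesics of the bi-invariant metric through \<open>U\<close> are \<open>t \<mapsto> U ** mat_exp (t *\<^sub>R A)\<close> with
  \<open>A\<close> skew-symmetric, of length \<open>sqrt (g_SO A A) = norm A / sqrt 2\<close> on the unit interval
  (lemma \<open>sqrt_g_SO\<close> below); the norm of \<open>real^'n^'n\<close> is the Frobenius norm (lemma
  \<open>norm_eq_Frobenius\<close>).  The distance is the least such length.  For \<open>U\<close> and \<open>V\<close> in
  \<open>SO\<close> the set below is nonempty and its infimum is attained, so \<open>Inf\<close> is the minimum.
\<close>

definition d_SO :: "real^'n^'n \<Rightarrow> real^'n^'n \<Rightarrow> real" where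
  "d_SO U V = Inf {(1 / sqrt 2) * norm A | A. A \<in> so \<and> mat_exp A = matrix_inv U ** V}"

lemma norm_eq_Frobenius:
  fixes A :: "real^'n^'n"
  shows "norm A = sqrt (\<Sum>i\<in>UNIV. \<Sum>j\<in>UNIV. (A $ i $ j)\<^sup>2)"
  by (simp add: norm_vec_def L2_set_def sum_nonneg)

lemma sqrt_g_SO:
  fixes A :: "real^'n^'n"
  assumes "A \<in> so"
  shows "sqrt (g_SO A A) = (1 / sqrt 2) * norm A"
proof -
  have "transpose A = - A"
    using assms by (simp add: so_def)
  then have "transpose A $ i $ j = (- A) $ i $ j" for i j
    by (rule arg_cong)
  then have skew: "A $ j $ i = - (A $ i $ j)" for i j
    unfolding transpose_def vec_lambda_beta vector_uminus_component .
  have entry: "A $ i $ j * A $ j $ i = - ((A $ i $ j)\<^sup>2)" for i j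
    by (simp only: skew[of i j] power2_eq_square mult_minus_right)
  have "trace (A ** A) = - (\<Sum>i\<in>UNIV. \<Sum>j\<in>UNIV. (A $ i $ j)\<^sup>2)"
    by (simp add: trace_def matrix_matrix_mult_def entry sum_negf)
  then show ?thesis
    by (simp add: g_SO_def norm_eq_Frobenius real_sqrt_divide)
qed

definition involution :: "real^'n^'n \<Rightarrow> bool" where
  "involution R \<longleftrightarrow> R \<in> SO \<and> R ** R = mat 1 \<and> R \<noteq> mat 1"

definition involution_level :: "real^'n^'n \<Rightarrow> nat" where
  "involution_level R = dim {x. R *v x = - x}"

definition sign_changes :: "('n::finite \<Rightarrow> real) set" where
  "sign_changes = {\<sigma>. (\<forall>i. \<sigma> i \<in> {1, -1}) \<and> (\<Prod>i\<in>UNIV. \<sigma> i) = 1}"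

definition sign_matrix :: "('n \<Rightarrow> real) \<Rightarrow> real^'n^'n" where
  "sign_matrix \<sigma> = (\<chi> i j. if i = j then \<sigma> i else 0)"

definition sign_level :: "('n::finite \<Rightarrow> real) \<Rightarrow> nat" where
  "sign_level \<sigma> = card {i. \<sigma> i = -1}"

definition sign_change_reducible :: "real^'n^'n \<Rightarrow> bool" where
  "sign_change_reducible R \<longleftrightarrow>
     (\<exists>\<sigma>\<in>sign_changes. d_SO (R ** sign_matrix \<sigma>) (mat 1) < d_SO R (mat 1))"

definition reducible_by_level :: "nat \<Rightarrow> real^'n^'n \<Rightarrow> bool" where
  "reducible_by_level m R \<longleftrightarrow>
     (\<exists>\<sigma>\<in>sign_changes. sign_level \<sigma> = m \<and>
        d_SO (R ** sign_matrix \<sigma>) (mat 1) < d_SO R (mat 1))"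

end

theory Submission
  imports Defs
begin

text \<open>
  A reducing sign change of an involution \<open>R\<close> of level \<open>2\<close> cannot have any level other than \<open>2\<close>,
  so the given one already serves.

  The involution \<open>R\<close> is a half turn of the plane \<open>E\<close> on which it is \<open>- 1\<close>
  (\<open>level_2_involution_pair\<close>), and \<open>pi\<close> times the infinitesimal rotation of \<open>E\<close> is a logarithm of
  it.  Hence \<open>R\<close> is at distance at most \<open>pi\<close> from the identity (\<open>d_SO_level_2_involution\<close>).

  Let \<open>\<sigma>\<close> be a sign change of level above \<open>2\<close>.  The \<open>- 1\<close> eigenspace of \<open>sign_matrix \<sigma>\<close> has
  dimension above \<open>2\<close>, so it contains a nonzero vector \<open>x\<close> orthogonal to \<open>E\<close>
  (\<open>exists_supported_orthogonal\<close>).  This vector is fixed by \<open>R\<close>, so \<open>R ** sign_matrix \<sigma>\<close> sends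
  \<open>x\<close> to \<open>- x\<close>.  A special orthogonal matrix with eigenvalue \<open>- 1\<close> is at distance at least \<open>pi\<close>
  from the identity (\<open>d_SO_ge_pi\<close>), because every skew-symmetric logarithm of it must turn some
  plane by at least a half turn (\<open>norm_log_ge_pi\<close>).  So \<open>\<sigma>\<close> does not reduce \<open>R\<close>.  Level \<open>0\<close> leaves
  \<open>R\<close> unchanged, and odd levels are excluded by the product condition on \<open>\<sigma>\<close>, which leaves level
  \<open>2\<close>.

  The lower bound on the distance is about an infimum, and requires in addition that some logarithm
  exists.  The lemma \<open>SO_mat_exp\<close> provides one for every special orthogonal matrix, by splitting off
  one rotated plane at a time (\<open>SO_rotated_plane\<close>).  The planes there, and the plane in
  \<open>norm_log_ge_pi\<close>, come from eigenvectors of symmetric maps on invariant subspaces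
  (\<open>symmetric_max_eigenvector\<close>).
\<close>

section \<open>The matrix exponential acting on vectors\<close>

lemma mat_pow_mult_vec: "mat_pow A k *v x = (((*v) A) ^^ k) x"
  by (induction k) (simp_all add: mat_pow_def flip: matrix_vector_mul_assoc)

text \<open>
  The Frobenius norm of \<open>mat_pow A k\<close> is at most a constant times \<open>K ^ k\<close>, where \<open>K\<close> bounds
  the operator norm of \<open>A\<close>, so the exponential series of \<open>K\<close> dominates.
\<close>

lemma mat_exp_summable:
  fixes A :: "real^'n^'n"
  shows "summable (\<lambda>k. (1 / fact k) *\<^sub>R mat_pow A k)"
proof -
  obtain K where K: "\<And>x. norm (A *v x) \<le> norm x * K" and "K > 0"
    using bounded_linear.pos_bounded[OF matrix_vector_mul_bounded_linear] by blast
  have pow: "norm (mat_pow A k *v x) \<le> K ^ k * norm x" for k x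
  proof (induction k)
    case (Suc k)
    have "norm (mat_pow A (Suc k) *v x) \<le> norm (mat_pow A k *v x) * K"
      using K by (simp add: mat_pow_mult_vec)
    also have "\<dots> \<le> K ^ k * norm x * K"
      using Suc \<open>K > 0\<close> by (intro mult_right_mono) auto
    finally show ?case by (simp add: mult_ac)
  qed (simp add: mat_pow_mult_vec)
  have entry: "\<bar>mat_pow A k $ i $ j\<bar> \<le> K ^ k" for k i j
  proof -
    have "mat_pow A k $ i $ j = (mat_pow A k *v axis j 1) $ i"
      by (simp add: matrix_vector_mul_component inner_axis)
    then show ?thesis
      using order_trans[OF component_le_norm_cart pow[of k "axis j 1"]] by (simp add: norm_axis_1)
  qed
  have "norm (mat_pow A k) \<le> real CARD('n) * real CARD('n) * K ^ k" for k
  proof -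
    have "norm (mat_pow A k) \<le> (\<Sum>i\<in>UNIV. \<Sum>j\<in>UNIV. \<bar>mat_pow A k $ i $ j\<bar>)"
      by (intro order_trans[OF L2_set_le_sum[of UNIV "\<lambda>i. norm (mat_pow A k $ i)", folded norm_vec_def]] sum_mono norm_le_l1_cart) auto
    also have "\<dots> \<le> (\<Sum>i\<in>(UNIV::'n set). \<Sum>j\<in>(UNIV::'n set). K ^ k)"
      by (intro sum_mono entry)
    finally show ?thesis by simp
  qed
  then have "norm ((1 / fact k) *\<^sub>R mat_pow A k) \<le> real CARD('n) * real CARD('n) * (K ^ k /\<^sub>R fact k)" for k
    by (simp add: field_simps)
  then show ?thesis
    by (intro summable_comparison_test'[OF summable_mult[OF summable_exp_generic]])
qed

text \<open>
  Matrix powers are awkward to manipulate, iterates of a linear map on a vector are not: every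
  property of \<open>mat_exp\<close> below is read off from this series.
\<close>

lemma mat_exp_mult_vec_sums:
  "(\<lambda>k. (1 / fact k) *\<^sub>R (((*v) A) ^^ k) x) sums (mat_exp A *v x)"
proof -
  have "bounded_linear (\<lambda>M. M *v x)" for x :: "real^'n"
    by (intro linear_conv_bounded_linear[THEN iffD1] linearI)
      (auto simp: matrix_vector_mult_add_rdistrib scaleR_matrix_vector_assoc)
  from bounded_linear.sums[OF this summable_sums[OF mat_exp_summable]]
  show ?thesis
    by (simp add: mat_exp_def mat_pow_mult_vec flip: scaleR_matrix_vector_assoc)
qed

text \<open>
  The exponential can be computed separately on each invariant subspace.  This replaces the
  product formula for exponentials of commuting matrices.
\<close>

lemma mat_exp_cong_on_invariant:
  assumes "x \<in> S" "\<And>z. z \<in> S \<Longrightarrow> A *v z \<in> S" "\<And>z. z \<in> S \<Longrightarrow> A *v z = B *v z"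
  shows "mat_exp A *v x = mat_exp B *v x"
proof -
  have "(((*v) A) ^^ k) x \<in> S \<and> (((*v) A) ^^ k) x = (((*v) B) ^^ k) x" for k
    using assms by (induction k) auto
  then show ?thesis
    using sums_unique2[OF mat_exp_mult_vec_sums[of A x]] mat_exp_mult_vec_sums[of B x] by simp
qed

lemma mat_exp_0: "mat_exp 0 = mat 1"
  unfolding matrix_eq
proof
  fix x :: "real^'n"
  have "(\<lambda>k. (1 / fact k) *\<^sub>R (((*v) (0::real^'n^'n)) ^^ k) x) sums (\<Sum>k\<in>{0}. (1 / fact k) *\<^sub>R (((*v) (0::real^'n^'n)) ^^ k) x)"
  proof (rule sums_finite)
    fix k :: nat assume "k \<notin> {0}"
    then show "(1 / fact k) *\<^sub>R (((*v) (0::real^'n^'n)) ^^ k) x = 0"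
      by (cases k) auto
  qed simp
  then show "mat_exp 0 *v x = mat 1 *v x"
    using sums_unique2[OF mat_exp_mult_vec_sums] by force
qed

lemma mat_exp_vec_commute: "mat_exp A *v (A *v x) = A *v (mat_exp A *v x)"
proof -
  have "A *v ((1 / fact k) *\<^sub>R (((*v) A) ^^ k) x) = (1 / fact k) *\<^sub>R (((*v) A) ^^ k) (A *v x)" for k
    by (simp add: matrix_vector_mult_scaleR funpow_swap1)
  then show ?thesis
    using sums_unique2[OF mat_exp_mult_vec_sums[of A "A *v x"]]
      bounded_linear.sums[OF matrix_vector_mul_bounded_linear[of A] mat_exp_mult_vec_sums[of A x]]
    by simp
qed

text \<open>
  On \<open>u\<close> and \<open>v\<close> the matrix acts as \<open>\<theta>\<close> times a quarter turn, so the terms of the exponential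
  series on \<open>u\<close> are those of the cosine and sine series.
\<close>

lemma mat_exp_rotation_vec:
  assumes u: "A *v u = \<theta> *\<^sub>R v" and v: "A *v v = - \<theta> *\<^sub>R u"
  shows "mat_exp A *v u = cos \<theta> *\<^sub>R u + sin \<theta> *\<^sub>R v"
proof -
  have "(1 / fact k) *\<^sub>R (((*v) A) ^^ k) u
      = (cos_coeff k *\<^sub>R \<theta> ^ k) *\<^sub>R u + (sin_coeff k *\<^sub>R \<theta> ^ k) *\<^sub>R v" for k
  proof (induction k)
    case 0
    then show ?case by (simp add: cos_coeff_def sin_coeff_def)
  next
    case (Suc k)
    have "(1 / fact (Suc k)) *\<^sub>R (((*v) A) ^^ Suc k) u
        = (1 / Suc k) *\<^sub>R (A *v ((1 / fact k) *\<^sub>R (((*v) A) ^^ k) u))"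
      by (simp add: matrix_vector_mult_scaleR)
    also have "\<dots> = (1 / Suc k) *\<^sub>R ((cos_coeff k *\<^sub>R \<theta> ^ k) *\<^sub>R (\<theta> *\<^sub>R v)
        + (sin_coeff k *\<^sub>R \<theta> ^ k) *\<^sub>R (- \<theta> *\<^sub>R u))"
      by (simp only: Suc matrix_vector_mult_scaleR matrix_vector_right_distrib u v)
    also have "\<dots> = (cos_coeff (Suc k) *\<^sub>R \<theta> ^ Suc k) *\<^sub>R u + (sin_coeff (Suc k) *\<^sub>R \<theta> ^ Suc k) *\<^sub>R v"
      by (simp add: cos_coeff_Suc sin_coeff_Suc scaleR_right_diff_distrib mult_ac)
    finally show ?case .
  qed
  moreover have "(\<lambda>k. (cos_coeff k *\<^sub>R \<theta> ^ k) *\<^sub>R u + (sin_coeff k *\<^sub>R \<theta> ^ k) *\<^sub>R v)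
      sums (cos \<theta> *\<^sub>R u + sin \<theta> *\<^sub>R v)"
    by (intro sums_add bounded_linear.sums[OF bounded_linear_scaleR_left] cos_converges sin_converges)
  ultimately show ?thesis
    using sums_unique2[OF mat_exp_mult_vec_sums[of A u]] by simp
qed

lemma mat_exp_kernel:
  assumes "A *v x = 0"
  shows "mat_exp A *v x = x"
proof -
  have "mat_exp A *v x = mat_exp 0 *v x"
    by (rule mat_exp_cong_on_invariant[of x "{z. A *v z = 0}"]) (use assms in auto)
  then show ?thesis
    by (simp add: mat_exp_0)
qed

section \<open>Skew-symmetric and orthogonal matrices\<close>

lemma matrix_vec_inner: "(A *v x) \<bullet> y = x \<bullet> (transpose A *v (y :: real^'n))"
  for A :: "real^'m^'n"
  by (metis dot_lmul_matrix inner_commute transpose_matrix_vector)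

lemma mat_exp_inner_transpose: "(mat_exp A *v x) \<bullet> y = x \<bullet> (mat_exp (transpose A) *v y)"
proof -
  have pow: "(((*v) A) ^^ k) x \<bullet> y = x \<bullet> (((*v) (transpose A)) ^^ k) y" for k
  proof (induction k arbitrary: y)
    case (Suc k)
    have "(((*v) A) ^^ Suc k) x \<bullet> y = (((*v) A) ^^ k) x \<bullet> (transpose A *v y)"
      by (simp add: matrix_vec_inner del: transpose_matrix_vector)
    also have "\<dots> = x \<bullet> (((*v) (transpose A)) ^^ Suc k) y"
      by (simp only: Suc funpow_Suc_right o_apply)
    finally show ?case .
  qed simp
  have "(\<lambda>k. ((1 / fact k) *\<^sub>R (((*v) A) ^^ k) x) \<bullet> y) sums ((mat_exp A *v x) \<bullet> y)"
    by (rule bounded_linear.sums[OF bounded_linear_inner_left mat_exp_mult_vec_sums])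
  moreover have "(\<lambda>k. x \<bullet> ((1 / fact k) *\<^sub>R (((*v) (transpose A)) ^^ k) y))
      sums (x \<bullet> (mat_exp (transpose A) *v y))"
    by (rule bounded_linear.sums[OF bounded_linear_inner_right mat_exp_mult_vec_sums])
  ultimately show ?thesis
    by (simp add: pow sums_unique2)
qed

lemma transpose_mat_exp: "transpose (mat_exp A) = mat_exp (transpose A)"
proof -
  have "x \<bullet> (transpose (mat_exp A) *v y) = x \<bullet> (mat_exp (transpose A) *v y)" for x y
    by (simp only: mat_exp_inner_transpose flip: matrix_vec_inner)
  then show ?thesis
    unfolding matrix_eq by (metis vector_eq_ldot)
qed

lemma matrix_vec_neg: "(- A) *v x = - (A *v x)" "A *v (- x) = - (A *v x)" for A :: "real^'n^'m"
  by (simp_all add: vec_eq_iff matrix_vector_mult_def sum_negf)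

lemma so_inner: "A \<in> so \<Longrightarrow> (A *v x) \<bullet> y = - (x \<bullet> (A *v y))"
  by (simp add: matrix_vec_inner so_def matrix_vec_neg del: transpose_matrix_vector)

lemma so_add: "A \<in> so \<Longrightarrow> B \<in> so \<Longrightarrow> A + B \<in> so"
proof -
  have "transpose (A + B) = transpose A + transpose B"
    by (simp add: transpose_def vec_eq_iff)
  then show "A \<in> so \<Longrightarrow> B \<in> so \<Longrightarrow> A + B \<in> so"
    by (simp add: so_def)
qed

lemma so_scaleR: "A \<in> so \<Longrightarrow> c *\<^sub>R A \<in> so"
  by (simp add: so_def transpose_scalar)

lemma orthogonal_matrix_inner:
  fixes Q :: "real^'n^'n"
  assumes "orthogonal_matrix Q"
  shows "(Q *v x) \<bullet> (Q *v y) = x \<bullet> y"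
  using assms by (simp add: matrix_vec_inner matrix_vector_mul_assoc orthogonal_matrix del: transpose_matrix_vector)

lemma orthogonal_matrix_transpose_eq:
  fixes Q :: "real^'n^'n"
  assumes "orthogonal_matrix Q" "Q *v x = y"
  shows "transpose Q *v y = x"
  using assms by (auto simp: matrix_vector_mul_assoc orthogonal_matrix simp del: transpose_matrix_vector)

section \<open>Eigenvectors of symmetric maps\<close>

text \<open>
  A maximizer \<open>x\<close> of the quadratic form on the unit sphere of \<open>W\<close>, with maximum \<open>\<mu>\<close>, is an
  eigenvector: the form \<open>\<mu> * (y \<bullet> y) - f y \<bullet> y\<close> is nonnegative on \<open>W\<close> and vanishes at \<open>x\<close>, hence
  its polarization vanishes on \<open>x\<close> and every \<open>y\<close> in \<open>W\<close>.
\<close>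

lemma symmetric_max_eigenvector:
  fixes f :: "'a::euclidean_space \<Rightarrow> 'a"
  assumes f: "linear f" and W: "subspace W" and inv: "\<And>x. x \<in> W \<Longrightarrow> f x \<in> W"
    and sym: "\<And>x y. f x \<bullet> y = x \<bullet> f y" and ne: "\<exists>x\<in>W. x \<noteq> 0"
  obtains x \<mu> where "x \<in> W" "norm x = 1" "f x = \<mu> *\<^sub>R x" "\<And>y. y \<in> W \<Longrightarrow> f y \<bullet> y \<le> \<mu> * (y \<bullet> y)"
proof -
  interpret f: linear f by fact
  let ?S = "W \<inter> sphere 0 1"
  have "compact ?S"
    using closed_subspace[OF W] by (intro closed_Int_compact) auto
  moreover obtain x0 where "x0 \<in> W" "x0 \<noteq> 0"
    using ne by blast
  then have "x0 /\<^sub>R norm x0 \<in> ?S"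
    using W by (simp add: subspace_scale)
  then have "?S \<noteq> {}" by blast
  moreover have "continuous_on ?S (\<lambda>y. f y \<bullet> y)"
    using f by (intro continuous_on_inner linear_continuous_on continuous_on_id)
      (simp add: linear_conv_bounded_linear)
  ultimately obtain x where x: "x \<in> ?S" and max: "\<And>y. y \<in> ?S \<Longrightarrow> f y \<bullet> y \<le> f x \<bullet> x"
    using continuous_attains_sup[of ?S "\<lambda>y. f y \<bullet> y"] by metis
  define \<mu> where "\<mu> = f x \<bullet> x"
  have nx: "norm x = 1" and xW: "x \<in> W" using x by auto
  then have xx: "x \<bullet> x = 1" by (simp add: norm_eq_1)
  have bound: "f y \<bullet> y \<le> \<mu> * (y \<bullet> y)" if "y \<in> W" for y
  proof (cases "y = 0")
    case False
    then have "y /\<^sub>R norm y \<in> ?S"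
      using that W by (simp add: subspace_scale)
    then have "(f y \<bullet> y) / (norm y)\<^sup>2 \<le> \<mu>"
      using max by (force simp: \<mu>_def f.scale power2_eq_square divide_inverse mult_ac)
    then show ?thesis
      using False by (simp add: divide_le_eq power2_norm_eq_inner)
  qed (simp add: f.zero)
  have orth: "(\<mu> *\<^sub>R x - f x) \<bullet> y = 0" if y: "y \<in> W" for y
  proof (rule ccontr)
    define b where "b = (\<mu> *\<^sub>R x - f x) \<bullet> y"
    define c where "c = \<bar>\<mu> * (y \<bullet> y) - f y \<bullet> y\<bar> + 1"
    assume "(\<mu> *\<^sub>R x - f x) \<bullet> y \<noteq> 0"
    then have "b \<noteq> 0" by (simp add: b_def)
    have "c > 0" by (simp add: c_def)
    \<comment> \<open>This \<open>t\<close> minimizes the quadratic \<open>2 * t * b + t\<^sup>2 * c\<close>, which bounds the form at \<open>x + t *\<^sub>R y\<close> from above.\<close>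
    define t where "t = - b / c"
    have "x + t *\<^sub>R y \<in> W"
      using W y xW by (simp add: subspace_add subspace_scale)
    from bound[OF this] have "0 \<le> 2 * t * b + t\<^sup>2 * (\<mu> * (y \<bullet> y) - f y \<bullet> y)"
      using sym[of y x] by (simp add: f.add f.scale inner_add_left inner_add_right inner_diff_left
          xx b_def \<mu>_def algebra_simps power2_eq_square inner_commute)
    also have "\<dots> \<le> 2 * t * b + t\<^sup>2 * c"
      by (intro add_left_mono mult_left_mono) (auto simp: c_def)
    also have "\<dots> = - b\<^sup>2 / c"
      using \<open>c > 0\<close> by (simp add: t_def field_simps power2_eq_square)
    also have "\<dots> < 0"
      using \<open>c > 0\<close> \<open>b \<noteq> 0\<close> by simp
    finally show False by simp
  qed
  have "\<mu> *\<^sub>R x - f x \<in> W"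
    using W xW inv by (simp add: subspace_diff subspace_scale)
  from orth[OF this] have "f x = \<mu> *\<^sub>R x" by simp
  with xW nx bound show ?thesis using that by blast
qed

section \<open>Rotations in a plane\<close>

text \<open>
  The infinitesimal rotation taking \<open>u\<close> to \<open>v\<close> and \<open>v\<close> to \<open>- u\<close> when the two are orthonormal.
\<close>

definition plane_gen :: "real^'n \<Rightarrow> real^'n \<Rightarrow> real^'n^'n" where
  "plane_gen u v = (\<chi> i j. v $ i * u $ j - u $ i * v $ j)"

lemma plane_gen_mult_vec: "plane_gen u v *v z = (u \<bullet> z) *\<^sub>R v - (v \<bullet> z) *\<^sub>R u"
  by (simp add: vec_eq_iff plane_gen_def matrix_vector_mult_def inner_vec_def
      sum_subtractf sum_distrib_left algebra_simps)

lemma plane_gen_so: "plane_gen u v \<in> so"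
  by (simp add: so_def plane_gen_def transpose_def vec_eq_iff)

lemma norm_plane_gen:
  assumes "norm u = 1" "norm v = 1" "u \<bullet> v = 0"
  shows "norm (plane_gen u v) = sqrt 2"
proof -
  have "(\<Sum>i\<in>UNIV. \<Sum>j\<in>UNIV. (v $ i * u $ j - u $ i * v $ j)\<^sup>2)
      = (\<Sum>i\<in>UNIV. \<Sum>j\<in>UNIV. (v $ i)\<^sup>2 * (u $ j)\<^sup>2) + (\<Sum>i\<in>UNIV. \<Sum>j\<in>UNIV. (u $ i)\<^sup>2 * (v $ j)\<^sup>2)
        - 2 * (\<Sum>i\<in>UNIV. \<Sum>j\<in>UNIV. (u $ i * v $ i) * (u $ j * v $ j))"
    by (simp add: power2_diff sum.distrib sum_subtractf sum_distrib_left power_mult_distrib mult_ac)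
  also have "\<dots> = (v \<bullet> v) * (u \<bullet> u) + (u \<bullet> u) * (v \<bullet> v) - 2 * ((u \<bullet> v) * (u \<bullet> v))"
    by (simp only: inner_vec_def inner_real_def sum_product power2_eq_square)
  also have "\<dots> = 2"
    using assms by (simp add: norm_eq_1)
  finally show ?thesis
    by (simp add: norm_eq_Frobenius plane_gen_def)
qed

locale orthonormal_pair =
  fixes u v :: "real^'n"
  assumes norm_u: "norm u = 1" and norm_v: "norm v = 1" and uv: "u \<bullet> v = 0"
begin

lemma inner_simps: "u \<bullet> u = 1" "v \<bullet> v = 1" "u \<bullet> v = 0" "v \<bullet> u = 0"
  using norm_u norm_v uv by (simp_all add: norm_eq_1 inner_commute)

text \<open>
  The plane of \<open>u\<close> and \<open>v\<close> together with its orthogonal complement spans the space, so identities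
  between the matrices below need only be tested on \<open>u\<close>, on \<open>v\<close> and on the complement.
\<close>

lemma matrix_eq_on_plane:
  fixes A B :: "real^'n^'n"
  assumes "A *v u = B *v u" "A *v v = B *v v"
    and perp: "\<And>w. u \<bullet> w = 0 \<Longrightarrow> v \<bullet> w = 0 \<Longrightarrow> A *v w = B *v w"
  shows "A = B"
  unfolding matrix_eq
proof
  fix z
  define w where "w = z - (u \<bullet> z) *\<^sub>R u - (v \<bullet> z) *\<^sub>R v"
  have "A *v w = B *v w"
    by (rule perp) (simp_all add: w_def inner_diff_right inner_simps)
  moreover have "M *v z = (u \<bullet> z) *\<^sub>R (M *v u) + (v \<bullet> z) *\<^sub>R (M *v v) + M *v w"
    for M :: "real^'n^'n"
    by (simp add: w_def matrix_vector_mult_diff_distrib matrix_vector_mult_scaleR)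
  ultimately show "A *v z = B *v z"
    using assms(1,2) by simp
qed

definition rot :: "real \<Rightarrow> real^'n^'n" where
  "rot \<theta> = mat_exp (\<theta> *\<^sub>R plane_gen u v)"

lemma rot_u: "rot \<theta> *v u = cos \<theta> *\<^sub>R u + sin \<theta> *\<^sub>R v"
  unfolding rot_def
  by (rule mat_exp_rotation_vec)
    (simp_all add: plane_gen_mult_vec inner_simps scaleR_matrix_vector_assoc[symmetric])

lemma rot_v: "rot \<theta> *v v = cos \<theta> *\<^sub>R v - sin \<theta> *\<^sub>R u"
  unfolding rot_def
  using mat_exp_rotation_vec[of "\<theta> *\<^sub>R plane_gen u v" v \<theta> "- u"]
  by (simp add: plane_gen_mult_vec inner_simps scaleR_matrix_vector_assoc[symmetric]
      matrix_vec_neg)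

lemma rot_perp: "u \<bullet> w = 0 \<Longrightarrow> v \<bullet> w = 0 \<Longrightarrow> rot \<theta> *v w = w"
  unfolding rot_def
  by (rule mat_exp_kernel) (simp add: plane_gen_mult_vec scaleR_matrix_vector_assoc[symmetric])

lemma rot_add: "rot a ** rot b = rot (a + b)"
  by (rule matrix_eq_on_plane)
    (simp_all add: matrix_vector_mul_assoc[symmetric] rot_u rot_v rot_perp cos_add sin_add
      matrix_vector_right_distrib matrix_vector_mult_diff_distrib matrix_vector_mult_scaleR
      scaleR_add_left scaleR_diff_left scaleR_add_right scaleR_diff_right mult_ac)

lemma rot_0: "rot 0 = mat 1"
  by (simp add: rot_def mat_exp_0)

text \<open>
  The determinant is \<open>1\<close> rather than \<open>- 1\<close> because a rotation is the square of the rotation by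
  half the angle.
\<close>

lemma rot_SO: "rot \<theta> \<in> SO"
proof -
  have "transpose (rot a) = rot (- a)" for a
    using so_scaleR[OF plane_gen_so[of u v], of a] by (simp add: rot_def transpose_mat_exp so_def)
  then have orth: "orthogonal_matrix (rot a)" for a
    by (simp add: orthogonal_matrix rot_add rot_0)
  have "det (rot \<theta>) = (det (rot (\<theta> / 2)))\<^sup>2"
    by (simp add: power2_eq_square det_mul[symmetric] rot_add)
  then have "det (rot \<theta>) = 1"
    using det_orthogonal_matrix[OF orth, of "\<theta> / 2"] by auto
  with orth show ?thesis
    by (simp add: SO_def rotation_matrix_def)
qed

text \<open>
  Since \<open>A\<close> is skew-symmetric and kills the plane, it also preserves the orthogonal complement of
  the plane, on which the generator vanishes.  So \<open>A\<close> and the generator exponentiate independently.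
\<close>

lemma mat_exp_add_plane_gen:
  assumes A: "A \<in> so" "A *v u = 0" "A *v v = 0"
  shows "mat_exp (A + \<theta> *\<^sub>R plane_gen u v) = rot \<theta> ** mat_exp A"
proof (rule matrix_eq_on_plane)
  let ?B = "A + \<theta> *\<^sub>R plane_gen u v"
  have Bu: "?B *v u = \<theta> *\<^sub>R v" and Bv: "?B *v v = - \<theta> *\<^sub>R u"
    using A by (simp_all add: matrix_vector_mult_add_rdistrib plane_gen_mult_vec inner_simps
        scaleR_matrix_vector_assoc[symmetric])
  show "mat_exp ?B *v u = rot \<theta> ** mat_exp A *v u"
    using mat_exp_rotation_vec[OF Bu Bv] A
    by (simp add: matrix_vector_mul_assoc[symmetric] mat_exp_kernel rot_u)
  show "mat_exp ?B *v v = rot \<theta> ** mat_exp A *v v"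
    using mat_exp_rotation_vec[of ?B v \<theta> "- u"] Bu Bv A
    by (simp add: matrix_vector_mul_assoc[symmetric] mat_exp_kernel rot_v matrix_vec_neg)
  fix w assume w: "u \<bullet> w = 0" "v \<bullet> w = 0"
  let ?S = "{z. u \<bullet> z = 0 \<and> v \<bullet> z = 0}"
  have "mat_exp ?B *v w = mat_exp A *v w"
  proof (rule mat_exp_cong_on_invariant)
    show "w \<in> ?S" using w by simp
    fix z assume z: "z \<in> ?S"
    show eq: "?B *v z = A *v z"
      using z by (simp add: matrix_vector_mult_add_rdistrib plane_gen_mult_vec
          scaleR_matrix_vector_assoc[symmetric])
    show "?B *v z \<in> ?S"
      using so_inner[OF A(1), of z] A by (simp add: eq inner_commute)
  qed
  moreover have "transpose A *v u = 0" "transpose A *v v = 0"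
    using A by (simp_all add: so_def matrix_vec_neg)
  then have "u \<bullet> (mat_exp A *v w) = 0" "v \<bullet> (mat_exp A *v w) = 0"
    using w by (simp_all add: inner_commute[of _ "_ *v _"] mat_exp_inner_transpose mat_exp_kernel)
       (simp_all add: inner_commute)
  ultimately show "mat_exp ?B *v w = rot \<theta> ** mat_exp A *v w"
    by (simp add: matrix_vector_mul_assoc[symmetric] rot_perp)
qed

end

section \<open>Logarithms of special orthogonal matrices\<close>

lemma SO_orthogonal: "Q \<in> SO \<Longrightarrow> orthogonal_matrix Q"
  by (simp add: SO_def rotation_matrix_def)

lemma SO_mult: "A \<in> SO \<Longrightarrow> B \<in> SO \<Longrightarrow> A ** B \<in> SO"
  by (simp add: SO_def rotation_matrix_def orthogonal_matrix_mul det_mul)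

lemma SO_transpose: "A \<in> SO \<Longrightarrow> transpose A \<in> SO"
  by (simp add: SO_def rotation_matrix_def)

text \<open>
  An orthogonal change of basis carries \<open>x\<close> to a coordinate axis and the reflection to a diagonal
  matrix.
\<close>

lemma det_reflection:
  fixes M :: "real^'n^'n"
  assumes "norm x = 1" "M *v x = - x" and perp: "\<And>z. x \<bullet> z = 0 \<Longrightarrow> M *v z = z"
  shows "det M = - 1"
proof -
  \<comment> \<open>Any coordinate axis will do.\<close>
  fix k :: 'n
  obtain Q where Q: "orthogonal_matrix Q" "Q *v axis k 1 = x"
    using orthogonal_matrix_exists_basis[OF assms(1)] by blast
  define D :: "real^'n^'n" where "D = (\<chi> i j. if i = j then (if i = k then - 1 else 1) else 0)"
  have D: "D *v axis j 1 = (if j = k then - axis k 1 else axis j 1)" for j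
    by (simp add: vec_eq_iff matrix_vector_mul_component inner_axis) (auto simp: D_def axis_def)
  have "(M ** Q) *v axis j 1 = (Q ** D) *v axis j 1" for j
  proof (cases "j = k")
    case False
    then have "x \<bullet> (Q *v axis j 1) = 0"
      using orthogonal_matrix_inner[OF Q(1), of "axis k 1" "axis j 1"] Q(2) by (simp add: inner_axis_axis)
    then show ?thesis
      using False perp by (simp add: D flip: matrix_vector_mul_assoc)
  qed (simp add: D Q assms matrix_vec_neg flip: matrix_vector_mul_assoc)
  then have "M ** Q = Q ** D"
    by (simp add: matrix_vector_mult_basis column_def vec_eq_iff)
  then have "det M * det Q = det Q * det D"
    by (metis det_mul)
  moreover have "det Q \<noteq> 0"
    using det_orthogonal_matrix[OF Q(1)] by auto
  moreover have "det D = (\<Prod>i\<in>UNIV. D $ i $ i)"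
    by (rule det_diagonal) (simp add: D_def)
  then have "det D = - 1"
    by (simp add: D_def)
  ultimately have "det M * det Q = - 1 * det Q" "det Q \<noteq> 0" by simp_all
  then show ?thesis
    using mult_right_cancel by blast
qed

text \<open>
  On the orthogonal complement \<open>W\<close> of the fixed space of \<open>M\<close>, let \<open>x\<close> be a unit vector maximizing
  \<open>(M *v x) \<bullet> x\<close>, and let \<open>c\<close> be the maximum.  Then \<open>x\<close> is an eigenvector of \<open>M + transpose M\<close>, so
  \<open>M *v (M *v x) = (2 * c) *\<^sub>R (M *v x) - x\<close> and the span of \<open>x\<close> and \<open>M *v x\<close> is invariant.  If
  \<open>\<bar>c\<bar> < 1\<close> it is a plane, rotated by the angle \<open>arccos c\<close>.  The value \<open>c = 1\<close> would make \<open>x\<close> fixed.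
  If \<open>c = - 1\<close>, maximality forces \<open>M = - 1\<close> on all of \<open>W\<close>, and any plane in \<open>W\<close> is rotated by
  \<open>pi\<close>; such a plane exists because otherwise \<open>M\<close> would be a reflection, of determinant \<open>- 1\<close>.
\<close>

lemma SO_rotated_plane:
  fixes M :: "real^'n^'n"
  assumes M: "M \<in> SO" "M \<noteq> mat 1"
  obtains u v \<theta> where "orthonormal_pair u v"
    "M *v u = cos \<theta> *\<^sub>R u + sin \<theta> *\<^sub>R v" "M *v v = cos \<theta> *\<^sub>R v - sin \<theta> *\<^sub>R u"
    "M *v u \<noteq> u" "\<And>z. M *v z = z \<Longrightarrow> u \<bullet> z = 0 \<and> v \<bullet> z = 0"
proof -
  let ?T = "transpose M"
  have orth: "orthogonal_matrix M" using M SO_orthogonal by blast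
  define W where "W = {w. \<forall>z. M *v z = z \<longrightarrow> w \<bullet> z = 0}"
  have W: "subspace W"
    by (auto simp: W_def subspace_def inner_add_left)
  have MW: "M *v w \<in> W" and TW: "?T *v w \<in> W" if "w \<in> W" for w
  proof -
    have "(M *v w) \<bullet> z = 0 \<and> (?T *v w) \<bullet> z = 0" if z: "M *v z = z" for z
    proof -
      have "(M *v w) \<bullet> z = w \<bullet> z"
        using orthogonal_matrix_inner[OF orth, of w z] z by simp
      moreover have "(?T *v w) \<bullet> z = w \<bullet> z"
        using z by (simp add: matrix_vec_inner[of ?T] del: transpose_matrix_vector)
      ultimately show ?thesis using z \<open>w \<in> W\<close> by (simp add: W_def)
    qed
    then show "M *v w \<in> W" "?T *v w \<in> W" by (auto simp: W_def)
  qed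
  obtain z where z: "M *v z \<noteq> z"
    using M(2) by (auto simp: matrix_eq)
  have moved: "M *v z - z \<in> W" for z
  proof -
    have "(M *v z - z) \<bullet> y = 0" if "M *v y = y" for y
      using orthogonal_matrix_inner[OF orth, of z y] that by (simp add: inner_diff_left)
    then show ?thesis by (simp add: W_def)
  qed
  have fixW: "w = 0" if "w \<in> W" "M *v w = w" for w
    using that by (auto simp: W_def)
  let ?f = "\<lambda>x. M *v x + ?T *v x"
  obtain x \<mu> where x: "x \<in> W" "norm x = 1" "?f x = \<mu> *\<^sub>R x"
    and max: "\<And>y. y \<in> W \<Longrightarrow> ?f y \<bullet> y \<le> \<mu> * (y \<bullet> y)"
  proof (rule symmetric_max_eigenvector[of ?f W])
    show "linear ?f"
      by (intro linear_compose_add matrix_vector_mul_linear)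
    show "\<And>x. x \<in> W \<Longrightarrow> ?f x \<in> W"
      using W MW TW by (simp add: subspace_add del: transpose_matrix_vector)
    show "?f x \<bullet> y = x \<bullet> ?f y" for x y
      by (simp add: inner_add_left inner_add_right matrix_vec_inner del: transpose_matrix_vector)
    show "\<exists>x\<in>W. x \<noteq> 0"
      using moved[of z] z by (intro bexI[of _ "M *v z - z"]) auto
  qed (use W in \<open>blast+\<close>)
  have Tin: "(?T *v y) \<bullet> y = (M *v y) \<bullet> y" for y
    using matrix_vec_inner[of ?T y y] inner_commute[of y "M *v y"] by (simp del: transpose_matrix_vector)
  define c where "c = (M *v x) \<bullet> x"
  have xx: "x \<bullet> x = 1" using x by (simp add: norm_eq_1)
  have xMx: "(M *v x) \<bullet> x = c" "x \<bullet> (M *v x) = c"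
    by (simp_all add: c_def inner_commute)
  have MM: "(M *v y) \<bullet> (M *v y) = y \<bullet> y" for y
    using orthogonal_matrix_inner[OF orth] .
  have "\<mu> = ?f x \<bullet> x" using x(3) xx by simp
  then have mu: "\<mu> = 2 * c" by (simp add: inner_add_left Tin xMx del: transpose_matrix_vector)
  have TM: "?T *v (M *v y) = y" "M *v (?T *v y) = y" for y
    using orth by (simp_all add: orthogonal_matrix_def matrix_vector_mul_assoc del: transpose_matrix_vector)
  have quad: "M *v (M *v x) = (2 * c) *\<^sub>R (M *v x) - x"
  proof -
    have "M *v (?f x) = (2 * c) *\<^sub>R (M *v x)"
      by (simp only: x(3) mu matrix_vector_mult_scaleR)
    then show ?thesis
      by (simp add: matrix_vector_right_distrib TM eq_diff_eq del: transpose_matrix_vector)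
  qed
  have "x \<noteq> 0" using x by auto
  then have Mx: "M *v x \<noteq> x" using fixW x by blast
  have sq: "(M *v x - c *\<^sub>R x) \<bullet> (M *v x - c *\<^sub>R x) = 1 - c\<^sup>2"
    by (simp add: inner_diff_left inner_diff_right MM xx xMx power2_eq_square)
  then have "1 - c\<^sup>2 \<ge> 0" by (metis inner_ge_zero)
  then have c_bounds: "- 1 \<le> c" "c \<le> 1"
    using abs_square_le_1[of c] by auto
  show thesis
  proof (cases "c\<^sup>2 = 1")
    case False
    define s where "s = sqrt (1 - c\<^sup>2)"
    have s: "s > 0" "s\<^sup>2 = 1 - c\<^sup>2"
      using \<open>1 - c\<^sup>2 \<ge> 0\<close> False by (auto simp: s_def)
    define v where "v = (M *v x - c *\<^sub>R x) /\<^sub>R s"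
    have Mx_eq: "M *v x = c *\<^sub>R x + s *\<^sub>R v"
      using s by (simp add: v_def)
    have vW: "v \<in> W"
      using W x(1) MW by (simp add: v_def subspace_diff subspace_scale)
    have "v \<bullet> v = ((M *v x - c *\<^sub>R x) \<bullet> (M *v x - c *\<^sub>R x)) / s\<^sup>2"
      by (simp add: v_def power2_eq_square divide_inverse)
    then have "v \<bullet> v = 1"
      using s sq False by simp
    moreover have "x \<bullet> v = 0"
      by (simp add: v_def inner_diff_right xx xMx)
    ultimately have pair: "orthonormal_pair x v"
      using x(2) by (simp add: orthonormal_pair_def norm_eq_1)
    have "M *v v = (M *v (M *v x) - c *\<^sub>R (M *v x)) /\<^sub>R s"
      by (simp add: v_def matrix_vector_mult_scaleR matrix_vector_mult_diff_distrib)
    also have "\<dots> = (c *\<^sub>R (M *v x) - x) /\<^sub>R s"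
      by (simp add: quad diff_right_commute flip: scaleR_left_diff_distrib)
    also have "\<dots> = (c * s / s) *\<^sub>R v - ((1 - c\<^sup>2) / s) *\<^sub>R x"
      by (simp add: Mx_eq algebra_simps divide_inverse power2_eq_square)
    also have "\<dots> = c *\<^sub>R v - s *\<^sub>R x"
      using s(1) by (simp only: s(2)[symmetric]) (simp add: power2_eq_square)
    finally have Mv: "M *v v = c *\<^sub>R v - s *\<^sub>R x" .
    have "cos (arccos c) = c" "sin (arccos c) = s"
      using c_bounds by (simp_all add: sin_arccos s_def)
    with that[OF pair, of "arccos c"] Mx_eq Mv Mx x(1) vW show thesis
      by (simp add: W_def)
  next
    case True
    have "c \<noteq> 1"
    proof
      assume "c = 1"
      then have "M *v x - x = 0" using sq by simp
      with Mx show False by simp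
    qed
    with True have c: "c = - 1" by (auto simp: power2_eq_1_iff)
    have neg: "M *v w = - w" if "w \<in> W" for w
    proof -
      have "(M *v w + w) \<bullet> (M *v w + w) = ?f w \<bullet> w + 2 * (w \<bullet> w)"
        using inner_commute[of w "M *v w"]
        by (simp add: inner_add_left inner_add_right MM Tin del: transpose_matrix_vector)
      also have "\<dots> \<le> 0" using max[OF that] by (simp add: mu c)
      finally have "M *v w + w = 0"
        by (metis inner_eq_zero_iff inner_ge_zero order_antisym)
      then show ?thesis by (simp add: eq_neg_iff_add_eq_0)
    qed
    show thesis
    proof (cases "\<exists>y\<in>W. x \<bullet> y = 0 \<and> y \<noteq> 0")
      case True
      then obtain y where y: "y \<in> W" "x \<bullet> y = 0" "y \<noteq> 0" by blast
      define v where "v = y /\<^sub>R norm y"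
      have vW: "v \<in> W" using y W by (simp add: v_def subspace_scale)
      show thesis
      proof (rule that[of x v pi])
        show "orthonormal_pair x v"
          using y x by (simp add: v_def orthonormal_pair_def)
        show "M *v x = cos pi *\<^sub>R x + sin pi *\<^sub>R v" "M *v v = cos pi *\<^sub>R v - sin pi *\<^sub>R x"
          using neg[OF x(1)] neg[OF vW] by simp_all
        show "M *v x \<noteq> x" by (rule Mx)
        show "x \<bullet> z = 0 \<and> v \<bullet> z = 0" if "M *v z = z" for z
          using that x(1) vW by (simp add: W_def)
      qed
    next
      case False
      have "M *v z = z" if z: "x \<bullet> z = 0" for z
      proof -
        have "x \<bullet> (M *v z - z) = 0"
          using orthogonal_matrix_inner[OF orth, of x z] neg[OF x(1)] z by (simp add: inner_diff_right)
        then show ?thesis using False moved[of z] by auto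
      qed
      then have "det M = - 1"
        using det_reflection[OF x(2) neg[OF x(1)]] by blast
      with M(1) show thesis by (simp add: SO_def rotation_matrix_def)
    qed
  qed
qed

text \<open>
  The exponential maps \<open>so\<close> onto \<open>SO\<close>: splitting off one rotated plane enlarges the fixed space,
  so the process ends.  The clause on fixed vectors is what makes the induction work, since it says
  that the logarithm of the remaining factor kills the plane that was split off.
\<close>

lemma SO_mat_exp:
  fixes M :: "real^'n^'n"
  assumes "M \<in> SO"
  shows "\<exists>A\<in>so. mat_exp A = M \<and> (\<forall>z. M *v z = z \<longrightarrow> A *v z = 0)"
  using assms
proof (induction "CARD('n) - dim {z. M *v z = z}" arbitrary: M rule: less_induct)
  case less
  show ?case
  proof (cases "M = mat 1")
    case True
    then show ?thesis
      by (intro bexI[of _ 0]) (simp_all add: mat_exp_0 so_def transpose_def vec_eq_iff)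
  next
    case False
    obtain u v \<theta> where pair: "orthonormal_pair u v"
      and Mu: "M *v u = cos \<theta> *\<^sub>R u + sin \<theta> *\<^sub>R v" and Mv: "M *v v = cos \<theta> *\<^sub>R v - sin \<theta> *\<^sub>R u"
      and moved: "M *v u \<noteq> u" and fixed: "\<And>z. M *v z = z \<Longrightarrow> u \<bullet> z = 0 \<and> v \<bullet> z = 0"
      using SO_rotated_plane[OF less.prems False] by blast
    interpret orthonormal_pair u v by (rule pair)
    define N where "N = rot (- \<theta>) ** M"
    have M_eq: "M = rot \<theta> ** N"
      by (simp add: N_def matrix_mul_assoc rot_add rot_0)
    have N_SO: "N \<in> SO"
      unfolding N_def by (intro SO_mult rot_SO less.prems)
    have "M *v u = rot \<theta> *v u" "M *v v = rot \<theta> *v v"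
      by (simp_all add: Mu Mv rot_u rot_v)
    then have Nuv: "N *v u = u" "N *v v = v"
      by (simp_all add: N_def matrix_vector_mul_assoc[symmetric])
        (simp_all add: matrix_vector_mul_assoc rot_add rot_0)
    have N_fix: "N *v z = z" if "M *v z = z" for z
      using fixed[OF that] that by (simp add: N_def rot_perp flip: matrix_vector_mul_assoc)
    have span: "span {z. B *v z = z} = {z. B *v z = z}" for B :: "real^'n^'n"
      by (auto simp: span_eq_iff subspace_def matrix_vector_right_distrib matrix_vector_mult_scaleR)
    have "{z. M *v z = z} \<subset> {z. N *v z = z}"
      using N_fix Nuv moved by auto
    then have "dim {z. M *v z = z} < dim {z. N *v z = z}"
      by (intro dim_psubset) (simp only: span)
    moreover have "dim {z. N *v z = z} \<le> CARD('n)"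
      using dim_subset_UNIV_cart by blast
    ultimately have "CARD('n) - dim {z. N *v z = z} < CARD('n) - dim {z. M *v z = z}"
      by linarith
    from less.hyps[OF this N_SO] obtain A where A: "A \<in> so" "mat_exp A = N" "\<And>z. N *v z = z \<Longrightarrow> A *v z = 0"
      by blast
    let ?B = "A + \<theta> *\<^sub>R plane_gen u v"
    show ?thesis
    proof (intro bexI[of _ ?B] conjI allI impI)
      show "?B \<in> so" using A by (intro so_add so_scaleR plane_gen_so)
      show "mat_exp ?B = M"
        using A Nuv by (simp add: mat_exp_add_plane_gen M_eq)
      show "?B *v z = 0" if "M *v z = z" for z
        using fixed[OF that] A(3) N_fix[OF that]
        by (simp add: matrix_vector_mult_add_rdistrib plane_gen_mult_vec scaleR_matrix_vector_assoc[symmetric])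
    qed
  qed
qed

section \<open>Logarithms of matrices with eigenvalue -1\<close>

text \<open>
  Bessel's inequality for each row of \<open>A\<close>.
\<close>

lemma norm_matrix_ge_orthonormal:
  fixes A :: "real^'n^'m"
  assumes "norm x = 1" "norm y = 1" "x \<bullet> y = 0"
  shows "(norm (A *v x))\<^sup>2 + (norm (A *v y))\<^sup>2 \<le> (norm A)\<^sup>2"
proof -
  have bessel: "(r \<bullet> x)\<^sup>2 + (r \<bullet> y)\<^sup>2 \<le> r \<bullet> r" for r
  proof -
    let ?w = "r - (r \<bullet> x) *\<^sub>R x - (r \<bullet> y) *\<^sub>R y"
    have "0 \<le> ?w \<bullet> ?w" by simp
    also have "?w \<bullet> ?w = r \<bullet> r - (r \<bullet> x)\<^sup>2 - (r \<bullet> y)\<^sup>2"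
      using assms by (simp add: inner_diff_left inner_diff_right norm_eq_1 inner_commute power2_eq_square)
    finally show ?thesis by simp
  qed
  have "(norm (A *v x))\<^sup>2 + (norm (A *v y))\<^sup>2 = (\<Sum>i\<in>UNIV. (A $ i \<bullet> x)\<^sup>2 + (A $ i \<bullet> y)\<^sup>2)"
    unfolding power2_norm_eq_inner inner_vec_def[of "A *v _"]
    by (simp add: matrix_vector_mul_component power2_eq_square sum.distrib)
  also have "\<dots> \<le> (\<Sum>i\<in>UNIV. A $ i \<bullet> A $ i)"
    by (intro sum_mono bessel)
  also have "\<dots> = (norm A)\<^sup>2"
    by (simp add: power2_norm_eq_inner inner_vec_def)
  finally show ?thesis .
qed

text \<open>
  The eigenspace \<open>E\<close> of \<open>mat_exp A\<close> for \<open>- 1\<close> is invariant under \<open>A\<close>, so it contains a unit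
  eigenvector \<open>x\<close> of the symmetric map \<open>x \<mapsto> A *v (A *v x)\<close>.  With \<open>l = norm (A *v x)\<close>, the matrix \<open>A\<close> acts on the
  plane of \<open>x\<close> and \<open>A *v x\<close> as \<open>l\<close> times a quarter turn, so \<open>mat_exp A\<close> rotates this plane by the
  angle \<open>l\<close>.  It sends \<open>x\<close> to \<open>- x\<close>, so \<open>l\<close> is at least \<open>pi\<close>, and both \<open>x\<close> and the direction of
  \<open>A *v x\<close> contribute \<open>l\<^sup>2\<close> to the squared Frobenius norm.
\<close>

lemma norm_log_ge_pi:
  fixes A :: "real^'n^'n"
  assumes A: "A \<in> so" and z: "mat_exp A *v z = - z" "z \<noteq> 0"
  shows "pi \<le> (1 / sqrt 2) * norm A"
proof -
  define E where "E = {z. mat_exp A *v z = - z}"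
  let ?f = "\<lambda>x. A *v (A *v x)"
  have AE: "A *v x \<in> E" if "x \<in> E" for x
    using that by (simp add: E_def mat_exp_vec_commute matrix_vec_neg)
  obtain x \<mu> where x: "x \<in> E" "norm x = 1" "?f x = \<mu> *\<^sub>R x"
  proof (rule symmetric_max_eigenvector[of ?f E])
    show "linear ?f"
      by (simp add: matrix_vector_mul_assoc)
    show "subspace E"
      by (auto simp: E_def subspace_def matrix_vector_right_distrib matrix_vector_mult_scaleR)
    show "?f x \<bullet> y = x \<bullet> ?f y" for x y
      by (simp add: so_inner[OF A])
    show "\<exists>x\<in>E. x \<noteq> 0" using z by (auto simp: E_def)
  qed (use AE in auto)
  define l where "l = norm (A *v x)"
  have xx: "x \<bullet> x = 1" using x by (simp add: norm_eq_1)
  have "\<mu> = ?f x \<bullet> x" using x xx by simp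
  then have mu: "\<mu> = - (l\<^sup>2)"
    by (simp add: so_inner[OF A] l_def power2_norm_eq_inner)
  have expx: "mat_exp A *v x = - x" using x by (simp add: E_def)
  have "l \<noteq> 0"
  proof
    assume "l = 0"
    then have "mat_exp A *v x = x" by (simp add: l_def mat_exp_kernel)
    then have "x = - x" using expx by simp
    then have "x = 0" by (simp add: eq_neg_iff_add_eq_0 flip: scaleR_2)
    with x show False by simp
  qed
  then have l: "l > 0" by (simp add: l_def)
  define y where "y = (A *v x) /\<^sub>R l"
  have Ax: "A *v x = l *\<^sub>R y" using l by (simp add: y_def)
  have Ay: "A *v y = - l *\<^sub>R x"
    using l x by (simp add: y_def matrix_vector_mult_scaleR mu power2_eq_square)
  have "(A *v x) \<bullet> x = 0"
    using so_inner[OF A, of x x] by (simp add: inner_commute)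
  then have xy: "x \<bullet> y = 0" by (simp add: y_def inner_commute)
  have y: "norm y = 1" using l by (simp add: y_def l_def)
  have "- x = cos l *\<^sub>R x + sin l *\<^sub>R y"
    using mat_exp_rotation_vec[OF Ax Ay] expx by simp
  then have "x \<bullet> (- x) = x \<bullet> (cos l *\<^sub>R x + sin l *\<^sub>R y)" by simp
  then have "cos l = - 1" by (simp add: inner_add_right xx xy)
  then have "l \<ge> pi"
    using cos_monotone_0_pi[of l pi] l by force
  have "l\<^sup>2 + l\<^sup>2 \<le> (norm A)\<^sup>2"
    using norm_matrix_ge_orthonormal[OF x(2) y xy, of A] l x(2) y by (simp add: Ax Ay)
  then have "(sqrt 2 * l)\<^sup>2 \<le> (norm A)\<^sup>2"
    by (simp add: power_mult_distrib)
  then have "sqrt 2 * l \<le> norm A"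
    by (rule power2_le_imp_le) simp
  then have "l \<le> (1 / sqrt 2) * norm A"
    by (simp add: field_simps)
  with \<open>l \<ge> pi\<close> show ?thesis by simp
qed

section \<open>Distances to the identity\<close>

lemma matrix_inv_orthogonal:
  fixes Q :: "real^'n^'n"
  assumes "orthogonal_matrix Q"
  shows "matrix_inv Q = transpose Q"
proof -
  have "\<exists>B. Q ** B = mat 1 \<and> B ** Q = mat 1"
    using assms by (auto simp: orthogonal_matrix_def)
  then have "Q ** matrix_inv Q = mat 1 \<and> matrix_inv Q ** Q = mat 1"
    unfolding matrix_inv_def by (rule someI_ex)
  then show ?thesis
    using assms by (metis matrix_mul_assoc matrix_mul_lid matrix_mul_rid orthogonal_matrix_def)
qed

text \<open>
  The infimum in \<open>d_SO\<close> inherits the lower bound on all logarithms only if it ranges over a nonempty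
  set, which is where surjectivity of the exponential enters.
\<close>

lemma d_SO_ge_pi:
  assumes Q: "Q \<in> SO" and x: "Q *v x = - x" "x \<noteq> 0"
  shows "pi \<le> d_SO Q (mat 1)"
  unfolding d_SO_def
proof (rule cInf_greatest)
  have inv: "matrix_inv Q = transpose Q"
    using Q by (simp add: SO_orthogonal matrix_inv_orthogonal)
  show "{1 / sqrt 2 * norm A |A. A \<in> so \<and> mat_exp A = matrix_inv Q ** mat 1} \<noteq> {}"
    using SO_mat_exp[OF SO_transpose[OF Q]] by (auto simp: inv simp del: transpose_matrix_vector)
  have "transpose Q *v (- x) = x"
    using orthogonal_matrix_transpose_eq[OF SO_orthogonal[OF Q] x(1)] .
  then have "transpose Q *v x = - x"
    by (metis matrix_vec_neg(2) minus_minus)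
  then have "pi \<le> 1 / sqrt 2 * norm A" if "A \<in> so" "mat_exp A = transpose Q" for A
    using norm_log_ge_pi[OF that(1) _ x(2)] that(2) by metis
  then show "pi \<le> r" if "r \<in> {1 / sqrt 2 * norm A |A. A \<in> so \<and> mat_exp A = matrix_inv Q ** mat 1}" for r
    using that by (auto simp: inv)
qed

lemma d_SO_le:
  assumes "A \<in> so" "mat_exp A = matrix_inv U ** V"
  shows "d_SO U V \<le> (1 / sqrt 2) * norm A"
  unfolding d_SO_def
  by (rule cInf_lower) (use assms in \<open>auto intro!: bdd_belowI[of _ 0]\<close>)

text \<open>
  An involution of level \<open>2\<close> is a half turn of a plane.  For \<open>w\<close> orthogonal to the plane,
  \<open>R *v w - w\<close> lies in the plane because \<open>R\<close> is an involution, and is orthogonal to it because \<open>R\<close>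
  preserves inner products; so it is \<open>0\<close>.
\<close>

lemma level_2_involution_pair:
  assumes R: "involution R" and "involution_level R = 2"
  obtains u v where "orthonormal_pair u v" "R *v u = - u" "R *v v = - v"
    "\<And>w. u \<bullet> w = 0 \<Longrightarrow> v \<bullet> w = 0 \<Longrightarrow> R *v w = w"
proof -
  let ?E = "{x. R *v x = - x}"
  have sub: "subspace ?E"
    by (auto simp: subspace_def matrix_vector_right_distrib matrix_vector_mult_scaleR)
  obtain B where B: "B \<subseteq> ?E" "pairwise orthogonal B" "\<forall>x\<in>B. norm x = 1"
      "card B = dim ?E" "span B = ?E"
    by (rule orthonormal_basis_subspace[OF sub]) blast
  obtain u v where uv: "B = {u, v}" "u \<noteq> v"
    using B(4) assms(2) by (auto simp: involution_level_def card_2_iff)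
  have pair: "orthonormal_pair u v"
    using B(2,3) uv by (auto simp: orthonormal_pair_def pairwise_def orthogonal_def)
  have orth: "orthogonal_matrix R" and RR: "R *v (R *v x) = x" for x
    using R by (simp_all add: involution_def SO_orthogonal matrix_vector_mul_assoc)
  have "R *v w = w" if w: "u \<bullet> w = 0" "v \<bullet> w = 0" for w
  proof -
    define d where "d = R *v w - w"
    have Ruv: "R *v u = - u" "R *v v = - v" using B(1) uv by auto
    have "d \<in> span {u, v}"
      using B(5) uv by (simp add: d_def matrix_vector_mult_diff_distrib RR)
    moreover have "orthogonal d a" if "a \<in> {u, v}" for a
      using that w Ruv orthogonal_matrix_inner[OF orth, of u w] orthogonal_matrix_inner[OF orth, of v w]
      by (auto simp: d_def orthogonal_def inner_diff_left inner_diff_right inner_commute)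
    ultimately have "orthogonal d d"
      by (rule orthogonal_to_span)
    then show ?thesis by (simp add: d_def orthogonal_self)
  qed
  with that[OF pair] B(1) uv show thesis by auto
qed

lemma d_SO_level_2_involution:
  assumes "involution R" "involution_level R = 2"
  shows "d_SO R (mat 1) \<le> pi"
proof -
  obtain u v where pair: "orthonormal_pair u v" and R: "R *v u = - u" "R *v v = - v"
    "\<And>w. u \<bullet> w = 0 \<Longrightarrow> v \<bullet> w = 0 \<Longrightarrow> R *v w = w"
    using level_2_involution_pair[OF assms] by blast
  interpret orthonormal_pair u v by (rule pair)
  have "rot pi = R"
    by (rule matrix_eq_on_plane) (simp_all add: R rot_u rot_v rot_perp)
  moreover have "orthogonal_matrix R" "R ** R = mat 1"
    using assms by (simp_all add: involution_def SO_orthogonal)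
  then have "matrix_inv R = R"
    by (metis matrix_inv_orthogonal matrix_mul_assoc matrix_mul_lid matrix_mul_rid orthogonal_matrix_def)
  ultimately have "mat_exp (pi *\<^sub>R plane_gen u v) = matrix_inv R ** mat 1"
    by (simp add: rot_def)
  from d_SO_le[OF so_scaleR[OF plane_gen_so] this] show ?thesis
    using norm_plane_gen[OF norm_u norm_v uv] by simp
qed

section \<open>Sign changes\<close>

lemma sign_matrix_mult_vec: "sign_matrix \<sigma> *v x = (\<chi> i. \<sigma> i * x $ i)"
  by (simp add: sign_matrix_def matrix_vector_mult_def if_distrib[of "\<lambda>t. t * _"] cong: if_cong)

lemma sign_matrix_SO:
  assumes "\<sigma> \<in> sign_changes"
  shows "sign_matrix \<sigma> \<in> SO"
proof -
  have sq: "\<sigma> i * \<sigma> i = 1" for i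
    using assms by (auto simp: sign_changes_def dest!: spec[of _ i])
  have "transpose (sign_matrix \<sigma>) = sign_matrix \<sigma>"
    by (simp add: sign_matrix_def transpose_def vec_eq_iff)
  then have "orthogonal_matrix (sign_matrix \<sigma>)"
    by (simp add: orthogonal_matrix matrix_eq sign_matrix_mult_vec sq vec_eq_iff mult.assoc[symmetric]
        flip: matrix_vector_mul_assoc)
  moreover have "det (sign_matrix \<sigma>) = 1"
    using assms by (subst det_diagonal) (simp_all add: sign_matrix_def sign_changes_def)
  ultimately show ?thesis
    by (simp add: SO_def rotation_matrix_def)
qed

lemma even_sign_level:
  assumes "\<sigma> \<in> sign_changes"
  shows "even (sign_level \<sigma>)"
proof -
  have "(\<Prod>i\<in>UNIV. \<sigma> i) = (\<Prod>i\<in>UNIV. if \<sigma> i = - 1 then - 1 else 1)"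
    using assms by (intro prod.cong) (auto simp: sign_changes_def)
  also have "\<dots> = (- 1) ^ sign_level \<sigma>"
    by (simp add: prod.If_cases sign_level_def)
  finally show ?thesis
    using assms by (simp add: sign_changes_def) (metis one_neq_neg_one minus_one_power_iff)
qed

text \<open>
  Two linear equations in more than two unknowns.  On vectors supported on \<open>J\<close>, the vectors \<open>u\<close> and
  \<open>v\<close> may be replaced by their truncations to \<open>J\<close>, so the solutions are an orthogonal complement
  inside the space of vectors supported on \<open>J\<close>.
\<close>

lemma exists_supported_orthogonal:
  fixes u v :: "real^'n" and J :: "'n set"
  assumes "card J > 2"
  obtains x where "x \<noteq> 0" "u \<bullet> x = 0" "v \<bullet> x = 0" "\<And>i. i \<notin> J \<Longrightarrow> x $ i = 0"
proof -
  let ?B = "{x::real^'n. \<forall>i. i \<notin> J \<longrightarrow> x $ i = 0}"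
  define r :: "real^'n \<Rightarrow> real^'n" where "r = (\<lambda>a. \<chi> i. if i \<in> J then a $ i else 0)"
  let ?A = "span {r u, r v}"
  have B: "subspace ?B"
    by (auto simp: subspace_def)
  have "?A \<subseteq> ?B"
    by (rule span_minimal[OF _ B]) (simp add: r_def)
  then have "dim {y \<in> ?B. \<forall>x\<in>?A. orthogonal x y} + dim ?A = dim ?B"
    by (intro dim_subspace_orthogonal_to_vectors B subspace_span)
  moreover have "dim ?A \<le> 2"
    using dim_le_card'[of "{r u, r v}"] by (simp add: card_insert_if split: if_splits)
  moreover have "dim ?B > 2"
    using assms dim_substandard_cart[of J, where 'a = real] by (simp add: dim_vec_eq)
  ultimately have "dim {y \<in> ?B. \<forall>x\<in>?A. orthogonal x y} > 0"
    by linarith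
  then have "\<not> {y \<in> ?B. \<forall>x\<in>?A. orthogonal x y} \<subseteq> {0}"
    unfolding dim_eq_0[symmetric] by (rule gr_implies_not0)
  then obtain y where y: "y \<noteq> 0" "y \<in> ?B" "\<forall>x\<in>?A. orthogonal x y"
    by blast
  have "a \<bullet> y = r a \<bullet> y" for a
    using y(2) by (auto simp: inner_vec_def r_def intro!: sum.cong)
  moreover have "r u \<bullet> y = 0" "r v \<bullet> y = 0"
    using y(3) by (simp_all add: orthogonal_def span_base)
  ultimately show thesis
    using that[of y] y by simp
qed

theorem proposition4p8:
  fixes R :: "real^'n^'n"
  assumes "CARD('n) \<ge> 2"
    and "involution R"
    and "involution_level R = 2"
    and "sign_change_reducible R"
  shows "reducible_by_level 2 R"
proof -
  obtain \<sigma> where \<sigma>: "\<sigma> \<in> sign_changes"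
    and less: "d_SO (R ** sign_matrix \<sigma>) (mat 1) < d_SO R (mat 1)"
    using assms(4) by (auto simp: sign_change_reducible_def)
  have "sign_level \<sigma> \<noteq> 0"
  proof
    assume "sign_level \<sigma> = 0"
    then have "\<sigma> i = 1" for i
      using \<sigma> by (auto simp: sign_level_def sign_changes_def)
    then have "sign_matrix \<sigma> = mat 1"
      by (simp add: sign_matrix_def mat_def vec_eq_iff)
    with less show False by simp
  qed
  moreover have "\<not> sign_level \<sigma> > 2"
  proof
    assume "sign_level \<sigma> > 2"
    then have large: "card {i. \<sigma> i = - 1} > 2"
      by (simp add: sign_level_def)
    obtain u v where R: "\<And>w. u \<bullet> w = 0 \<Longrightarrow> v \<bullet> w = 0 \<Longrightarrow> R *v w = w"
      using level_2_involution_pair[OF assms(2,3)] by metis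
    obtain x where x: "x \<noteq> 0" "u \<bullet> x = 0" "v \<bullet> x = 0" "\<And>i. i \<notin> {i. \<sigma> i = - 1} \<Longrightarrow> x $ i = 0"
      using exists_supported_orthogonal[OF large] by metis
    have "\<sigma> i * x $ i = - (x $ i)" for i
      using x(4)[of i] by (cases "\<sigma> i = - 1") auto
    then have "sign_matrix \<sigma> *v x = - x"
      by (simp add: sign_matrix_mult_vec vec_eq_iff)
    then have "(R ** sign_matrix \<sigma>) *v x = - x"
      using R x by (simp add: matrix_vec_neg flip: matrix_vector_mul_assoc)
    moreover have "R ** sign_matrix \<sigma> \<in> SO"
      using assms(2) \<sigma> by (simp add: involution_def SO_mult sign_matrix_SO)
    ultimately have "pi \<le> d_SO (R ** sign_matrix \<sigma>) (mat 1)"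
      using d_SO_ge_pi x(1) by blast
    with less d_SO_level_2_involution[OF assms(2,3)] show False by linarith
  qed
  ultimately have "sign_level \<sigma> = 2"
    using even_sign_level[OF \<sigma>] by (cases "sign_level \<sigma> = 1") auto
  with \<sigma> less show ?thesis
    by (auto simp: reducible_by_level_def)
qed

end
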